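(* Let $n,m\ge 1$, let $B_0,B_1,\dots,B_m$ be $n\times n$ complex matrices, let $\alpha_1,\dots,\alpha_m$ be complex numbers with $|\alpha_1|<|\alpha_2|<\cdots<|\alpha_m|$, and let $$T(\lambda)=-B_0+I\lambda+\frac{B_1}{\lambda-\alpha_1}+\cdots+\frac{B_m}{\lambda-\alpha_m}.$$ Let $E$ be the $(m+1)n\times(m+1)n$ block matrix (with $n\times n$ blocks) $$E=\begin{bmatrix}0&\cdots&0&-I\\ \vdots&\ddots&\vdots&\vdots\\ 0&\cdots&0&-I\\ B_1&\cdots&B_m&B_0\end{bmatrix},$$ i.e. the first $m$ block rows are $(0,\dots,0,-I)$ and the last block row is $(B_1,\dots,B_m,B_0)$. Let $\|\cdot\|$ be any matrix norm on $M_{(m+1)n}(\mathbb{C})$ induced by an absolute norm on $\mathbb{C}^{(m+1)n}$. If $\lambda_0$ is an eigenvalue of $T(\lambda)$, then $$|\lambda_0|\le \|E\|+|\alpha_m|.$$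
   Context: $I$ denotes the $n\times n$ identity matrix. A complex number $\lambda_0$ is an eigenvalue of the rational matrix $T(\lambda)$ if $T(\lambda_0)$ has finite entries and there is a nonzero $v\in\mathbb{C}^n$ with $T(\lambda_0)v=0$. A norm on $\mathbb{C}^N$ is absolute if the norm of a vector depends only on the moduli of its entries. A matrix norm is induced by a vector norm if it is the corresponding operator norm. *)

theory Defs
  imports
    "Jordan_Normal_Form.Matrix"
    "HOL-Computational_Algebra.Polynomial_Factorial"
    "HOL-Computational_Algebra.Field_as_Ring"
begin

text \<open>
  Rational functions are elements of the fraction field of \<^typ>\<open>complex poly\<close>. Since
  \<^const>\<open>quot_of_fract\<close> yields the reduced form, a removable singularity does not count as a
  pole: the value is the one of the reduced fraction.
\<close>

definition finite_at :: "complex poly fract \<Rightarrow> complex \<Rightarrow> bool" where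
  "finite_at f z \<longleftrightarrow> poly (snd (quot_of_fract f)) z \<noteq> 0"

definition value_at :: "complex poly fract \<Rightarrow> complex \<Rightarrow> complex" where
  "value_at f z = poly (fst (quot_of_fract f)) z / poly (snd (quot_of_fract f)) z"

lemma at_Fract:
  assumes "poly q z \<noteq> 0"
  shows "finite_at (Fract p q) z" "value_at (Fract p q) z = poly p z / poly q z"
proof -
  define a b where "a = fst (quot_of_fract (Fract p q))" and "b = snd (quot_of_fract (Fract p q))"
  have q: "q \<noteq> 0" using assms by auto
  have b: "b \<noteq> 0" and cop: "coprime a b"
    unfolding a_def b_def by (simp_all add: coprime_quot_of_fract)
  have "Fract a b = Fract p q"
    unfolding a_def b_def using Fract_quot_of_fract by metis
  hence eq: "a * q = p * b"
    using b q by (simp add: eq_fract)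
  hence "b dvd q"
    by (metis cop coprime_commute coprime_dvd_mult_right_iff dvd_triv_right)
  hence bz: "poly b z \<noteq> 0"
    using assms by auto
  have "poly a z * poly q z = poly p z * poly b z"
    using arg_cong[OF eq, of "\<lambda>r. poly r z"] by simp
  thus "value_at (Fract p q) z = poly p z / poly q z" "finite_at (Fract p q) z"
    using bz assms by (simp_all add: value_at_def finite_at_def a_def b_def field_simps)
qed

definition rational_eigenvalue :: "complex poly fract mat \<Rightarrow> complex \<Rightarrow> bool" where
  "rational_eigenvalue T z \<longleftrightarrow>
     (\<forall>i < dim_row T. \<forall>j < dim_col T. finite_at (T $$ (i, j)) z) \<and>
     (\<exists>v \<in> carrier_vec (dim_col T). v \<noteq> 0\<^sub>v (dim_col T) \<and>
        map_mat (\<lambda>f. value_at f z) T *\<^sub>v v = 0\<^sub>v (dim_row T))"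

definition T_mat ::
    "nat \<Rightarrow> nat \<Rightarrow> (nat \<Rightarrow> complex mat) \<Rightarrow> (nat \<Rightarrow> complex) \<Rightarrow> complex poly fract mat" where
  "T_mat n m B \<alpha> = mat n n (\<lambda>(p, q).
     - Fract [: B 0 $$ (p, q) :] 1 + (1\<^sub>m n $$ (p, q)) * Fract [: 0, 1 :] 1
     + (\<Sum>j = 1..m. Fract [: B j $$ (p, q) :] [: - \<alpha> j, 1 :]))"

text \<open>Block rows and columns are numbered from \<open>0\<close> to \<open>k - 1\<close>.\<close>

definition block_mat :: "nat \<Rightarrow> nat \<Rightarrow> (nat \<Rightarrow> nat \<Rightarrow> 'a mat) \<Rightarrow> 'a mat" where
  "block_mat n k F = mat (k * n) (k * n)
     (\<lambda>(r, c). F (r div n) (c div n) $$ (r mod n, c mod n))"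

definition E_mat :: "nat \<Rightarrow> nat \<Rightarrow> (nat \<Rightarrow> complex mat) \<Rightarrow> complex mat" where
  "E_mat n m B = block_mat n (m + 1) (\<lambda>i j.
     if i < m then (if j < m then 0\<^sub>m n n else - 1\<^sub>m n)
     else (if j < m then B (j + 1) else B 0))"

definition is_norm :: "nat \<Rightarrow> (complex vec \<Rightarrow> real) \<Rightarrow> bool" where
  "is_norm N \<nu> \<longleftrightarrow>
     (\<forall>x \<in> carrier_vec N. 0 \<le> \<nu> x \<and> (\<nu> x = 0 \<longleftrightarrow> x = 0\<^sub>v N)) \<and>
     (\<forall>c. \<forall>x \<in> carrier_vec N. \<nu> (c \<cdot>\<^sub>v x) = cmod c * \<nu> x) \<and>
     (\<forall>x \<in> carrier_vec N. \<forall>y \<in> carrier_vec N. \<nu> (x + y) \<le> \<nu> x + \<nu> y)"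

definition absolute_norm :: "nat \<Rightarrow> (complex vec \<Rightarrow> real) \<Rightarrow> bool" where
  "absolute_norm N \<nu> \<longleftrightarrow> is_norm N \<nu> \<and>
     (\<forall>x \<in> carrier_vec N. \<forall>y \<in> carrier_vec N.
        (\<forall>i < N. cmod (x $ i) = cmod (y $ i)) \<longrightarrow> \<nu> x = \<nu> y)"

text \<open>
  For a norm \<open>\<nu>\<close> and \<open>N \<ge> 1\<close> the supremum is taken over a nonempty bounded set; values outside
  \<^term>\<open>carrier_mat N N\<close> are left unconstrained.
\<close>

definition induced_matrix_norm ::
    "nat \<Rightarrow> (complex vec \<Rightarrow> real) \<Rightarrow> (complex mat \<Rightarrow> real) \<Rightarrow> bool" where
  "induced_matrix_norm N \<nu> \<mu> \<longleftrightarrow>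
     (\<forall>A \<in> carrier_mat N N. \<mu> A = (SUP x \<in> {x \<in> carrier_vec N. \<nu> x = 1}. \<nu> (A *\<^sub>v x)))"

end

theory Submission
  imports Defs
begin

text \<open>
  The rational eigenvalue problem is linearised. If \<open>z\<close> is none of the \<open>\<alpha> j\<close> and \<open>T(z) v = 0\<close> with
  \<open>v \<noteq> 0\<close>, then the block vector \<open>w\<close> with blocks \<open>- v / (z - \<alpha> j)\<close>, for \<open>j = 1, \<dots>, m\<close>, followed by
  \<open>v\<close> satisfies \<open>z w = E w + D w\<close>, where \<open>D\<close> is the diagonal matrix with diagonal blocks
  \<open>\<alpha> 1 I, \<dots>, \<alpha> m I, 0\<close>: the first \<open>m\<close> block rows say \<open>(z - \<alpha> j) w\<^sub>j = - v\<close>, and the last one says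
  \<open>T(z) v = 0\<close> (\<open>linearization\<close>).

  Taking norms, \<open>\<bar>z\<bar> \<nu> w \<le> \<nu> (E w) + \<nu> (D w)\<close>. The first summand is at most \<open>\<mu> E * \<nu> w\<close>
  (\<open>induced_matrix_norm_bound\<close>). For the second, an absolute norm is monotone in the moduli of the
  entries (\<open>absolute_norm_mono\<close>), and every entry of \<open>D w\<close> is at most \<open>\<bar>\<alpha> m\<bar>\<close> times the
  corresponding entry of \<open>w\<close> in modulus. Dividing by \<open>\<nu> w > 0\<close> gives the bound.

  If \<open>z\<close> is one of the \<open>\<alpha> j\<close> (which can happen when \<open>B j = 0\<close>), then \<open>\<bar>z\<bar> \<le> \<bar>\<alpha> m\<bar>\<close>, and it is enough
  that \<open>\<mu> E \<ge> 0\<close>.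
\<close>

section \<open>Absolute norms and induced matrix norms\<close>

text \<open>
  A complex number of modulus at most \<open>r\<close> is, up to its argument, the midpoint of two conjugate
  numbers of modulus \<open>r\<close>. Doing this in every entry at once writes a vector with the moduli of
  \<open>2 x\<close> as a sum of two vectors that both have the entrywise moduli of \<open>y\<close>; the triangle
  inequality then gives \<open>2 \<nu> x \<le> 2 \<nu> y\<close>.
\<close>
lemma absolute_norm_mono:
  assumes nu: "absolute_norm N \<nu>" and x: "x \<in> carrier_vec N" and y: "y \<in> carrier_vec N"
    and le: "\<And>i. i < N \<Longrightarrow> cmod (x $ i) \<le> cmod (y $ i)"
  shows "\<nu> x \<le> \<nu> y"
proof -
  define s where "s i = sqrt ((cmod (y $ i))\<^sup>2 - (cmod (x $ i))\<^sup>2)" for i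
  define p where "p = vec N (\<lambda>i. Complex (cmod (x $ i)) (s i))"
  define q where "q = vec N (\<lambda>i. Complex (cmod (x $ i)) (- s i))"
  have car: "p \<in> carrier_vec N" "q \<in> carrier_vec N" by (simp_all add: p_def q_def)
  have s2: "(s i)\<^sup>2 = (cmod (y $ i))\<^sup>2 - (cmod (x $ i))\<^sup>2" if "i < N" for i
    using le[OF that] by (simp add: s_def power_mono)
  have abs: "\<nu> a = \<nu> b"
    if "a \<in> carrier_vec N" "b \<in> carrier_vec N" "\<And>i. i < N \<Longrightarrow> cmod (a $ i) = cmod (b $ i)" for a b
    using nu that unfolding absolute_norm_def by blast
  have "\<nu> p = \<nu> y" "\<nu> q = \<nu> y"
    using y car s2 by (auto intro!: abs simp: p_def q_def cmod_def[of "Complex _ _"])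
  moreover have "\<nu> (p + q) = \<nu> (2 \<cdot>\<^sub>v x)"
  proof (rule abs)
    fix i assume i: "i < N"
    have "(p + q) $ i = of_real (2 * cmod (x $ i))"
      using i by (simp add: p_def q_def complex_eq_iff)
    thus "cmod ((p + q) $ i) = cmod ((2 \<cdot>\<^sub>v x) $ i)"
      using i x by (simp add: norm_mult)
  qed (use x car in auto)
  moreover have "\<nu> (p + q) \<le> \<nu> p + \<nu> q" "\<nu> (2 \<cdot>\<^sub>v x) = cmod 2 * \<nu> x"
    using nu x car unfolding absolute_norm_def is_norm_def by blast+
  ultimately show ?thesis by simp
qed

lemma is_norm_zero: "is_norm N \<nu> \<Longrightarrow> \<nu> (0\<^sub>v N) = 0"
  unfolding is_norm_def by (metis zero_carrier_vec)

lemma is_norm_pos: "is_norm N \<nu> \<Longrightarrow> x \<in> carrier_vec N \<Longrightarrow> x \<noteq> 0\<^sub>v N \<Longrightarrow> 0 < \<nu> x"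
  unfolding is_norm_def by (metis order_le_less)

lemma is_norm_unit_vec_pos:
  assumes "is_norm N \<nu>" and "j < N"
  shows "0 < \<nu> (unit_vec N j)"
proof (rule is_norm_pos[OF assms(1) unit_vec_carrier])
  show "unit_vec N j \<noteq> 0\<^sub>v N"
    using assms(2) by (metis index_unit_vec(1) index_zero_vec(1) zero_neq_one)
qed

lemma is_norm_sum_le:
  fixes k :: nat
  assumes nu: "is_norm N \<nu>" and f: "\<And>j. j < k \<Longrightarrow> f j \<in> carrier_vec N"
  shows "\<nu> (vec N (\<lambda>i. \<Sum>j<k. f j $ i)) \<le> (\<Sum>j<k. \<nu> (f j))"
  using f
proof (induction k)
  case 0
  have "vec N (\<lambda>i. \<Sum>j<0. f j $ i) = 0\<^sub>v N" by auto
  thus ?case using is_norm_zero[OF nu] by simp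
next
  case (Suc k)
  have "vec N (\<lambda>i. \<Sum>j<Suc k. f j $ i) = vec N (\<lambda>i. \<Sum>j<k. f j $ i) + f k"
    using Suc.prems[of k] by auto
  moreover have "\<nu> (vec N (\<lambda>i. \<Sum>j<k. f j $ i) + f k) \<le> \<nu> (vec N (\<lambda>i. \<Sum>j<k. f j $ i)) + \<nu> (f k)"
    using nu Suc.prems[of k] unfolding is_norm_def by auto
  ultimately show ?case using Suc by force
qed

text \<open>
  Expand \<open>A x\<close> in the columns of \<open>A\<close>. Monotonicity bounds each coefficient, since
  \<open>\<bar>x j\<bar> \<nu> (e j) \<le> \<nu> x\<close>; for an absolute norm this replaces the compactness argument by which linear
  maps are shown to be bounded in a general norm.
\<close>
lemma absolute_norm_mult_mat_bounded:
  assumes nu: "absolute_norm N \<nu>" and A: "A \<in> carrier_mat N N"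
  obtains K where "\<And>x. x \<in> carrier_vec N \<Longrightarrow> \<nu> (A *\<^sub>v x) \<le> K * \<nu> x"
proof
  have nrm: "is_norm N \<nu>" using nu by (simp add: absolute_norm_def)
  fix x :: "complex vec" assume x: "x \<in> carrier_vec N"
  have Ax: "A *\<^sub>v x = vec N (\<lambda>i. \<Sum>j<N. (x $ j \<cdot>\<^sub>v col A j) $ i)"
    using A x by (intro eq_vecI)
      (auto simp: scalar_prod_def lessThan_atLeast0 mult.commute intro!: sum.cong)
  have "\<nu> (A *\<^sub>v x) \<le> (\<Sum>j<N. \<nu> (x $ j \<cdot>\<^sub>v col A j))"
    unfolding Ax using A by (intro is_norm_sum_le[OF nrm]) auto
  also have "\<dots> \<le> (\<Sum>j<N. \<nu> (col A j) / \<nu> (unit_vec N j) * \<nu> x)"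
  proof (rule sum_mono)
    fix j assume "j \<in> {..<N}"
    hence j: "j < N" by simp
    have pos: "0 < \<nu> (unit_vec N j)"
      using nrm j by (rule is_norm_unit_vec_pos)
    have "\<nu> (x $ j \<cdot>\<^sub>v unit_vec N j) \<le> \<nu> x"
      using x j by (intro absolute_norm_mono[OF nu]) (auto simp: unit_vec_def)
    hence "cmod (x $ j) * \<nu> (unit_vec N j) \<le> \<nu> x"
      using nrm by (simp add: is_norm_def)
    hence "cmod (x $ j) \<le> \<nu> x / \<nu> (unit_vec N j)"
      using pos by (simp add: field_simps)
    moreover have col: "col A j \<in> carrier_vec N" using A by auto
    moreover have "0 \<le> \<nu> (col A j)"
      using nrm col by (simp add: is_norm_def)
    ultimately have "cmod (x $ j) * \<nu> (col A j) \<le> \<nu> x / \<nu> (unit_vec N j) * \<nu> (col A j)"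
      by (intro mult_right_mono)
    thus "\<nu> (x $ j \<cdot>\<^sub>v col A j) \<le> \<nu> (col A j) / \<nu> (unit_vec N j) * \<nu> x"
      using nrm col by (simp add: is_norm_def mult.commute)
  qed
  finally show "\<nu> (A *\<^sub>v x) \<le> (\<Sum>j<N. \<nu> (col A j) / \<nu> (unit_vec N j)) * \<nu> x"
    by (simp add: sum_distrib_right)
qed

text \<open>
  The supremum that defines \<open>\<mu> A\<close> is an upper bound only because it is taken over a bounded set,
  which \<open>absolute_norm_mult_mat_bounded\<close> provides.
\<close>
lemma induced_matrix_norm_bound:
  assumes nu: "absolute_norm N \<nu>" and mu: "induced_matrix_norm N \<nu> \<mu>"
    and A: "A \<in> carrier_mat N N" and x: "x \<in> carrier_vec N"
  shows "\<nu> (A *\<^sub>v x) \<le> \<mu> A * \<nu> x"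
proof (cases "x = 0\<^sub>v N")
  case True
  moreover have "A *\<^sub>v 0\<^sub>v N = 0\<^sub>v N" using A by auto
  moreover have "\<nu> (0\<^sub>v N) = 0"
    using nu by (simp add: absolute_norm_def is_norm_zero)
  ultimately show ?thesis using True by simp
next
  case False
  have nrm: "is_norm N \<nu>" using nu by (simp add: absolute_norm_def)
  obtain K where K: "\<And>x. x \<in> carrier_vec N \<Longrightarrow> \<nu> (A *\<^sub>v x) \<le> K * \<nu> x"
    using absolute_norm_mult_mat_bounded[OF nu A] by blast
  have pos: "0 < \<nu> x"
    using nrm x False by (rule is_norm_pos)
  define u where "u = complex_of_real (1 / \<nu> x) \<cdot>\<^sub>v x"
  have u: "u \<in> carrier_vec N" using x by (simp add: u_def)
  have "cmod (complex_of_real (1 / \<nu> x)) = 1 / \<nu> x"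
    using pos by (simp only: norm_of_real) simp
  hence scale: "\<nu> (complex_of_real (1 / \<nu> x) \<cdot>\<^sub>v y) = 1 / \<nu> x * \<nu> y" if "y \<in> carrier_vec N" for y
    using nrm that unfolding is_norm_def by metis
  have "\<nu> u = 1" using scale[OF x] pos by (simp add: u_def)
  hence "\<nu> (A *\<^sub>v u) \<le> (SUP x \<in> {x \<in> carrier_vec N. \<nu> x = 1}. \<nu> (A *\<^sub>v x))"
    using u K by (intro cSUP_upper bdd_aboveI[of _ K]) fastforce+
  also have "\<dots> = \<mu> A" using mu A by (simp add: induced_matrix_norm_def)
  also have "A *\<^sub>v u = complex_of_real (1 / \<nu> x) \<cdot>\<^sub>v (A *\<^sub>v x)"
    unfolding u_def using A x by (rule mult_mat_vec)
  also have "\<nu> \<dots> = 1 / \<nu> x * \<nu> (A *\<^sub>v x)"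
    using A x by (intro scale) auto
  finally show ?thesis using pos by (simp add: field_simps)
qed

lemma induced_matrix_norm_nonneg:
  assumes "absolute_norm N \<nu>" and "induced_matrix_norm N \<nu> \<mu>"
    and A: "A \<in> carrier_mat N N" and "0 < N"
  shows "0 \<le> \<mu> A"
proof -
  have nrm: "is_norm N \<nu>" using assms(1) by (simp add: absolute_norm_def)
  have "0 < \<nu> (unit_vec N 0)"
    using nrm \<open>0 < N\<close> by (rule is_norm_unit_vec_pos)
  moreover have "0 \<le> \<nu> (A *\<^sub>v unit_vec N 0)"
    using nrm A unfolding is_norm_def by (metis mult_mat_vec_carrier unit_vec_carrier)
  ultimately show ?thesis
    using induced_matrix_norm_bound[OF assms(1-3), of "unit_vec N 0"]
    by (smt (verit) mult_neg_pos unit_vec_carrier)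
qed

section \<open>Evaluation of rational functions\<close>

lemma at_add:
  assumes "finite_at f z" "finite_at g z"
  shows "finite_at (f + g) z" "value_at (f + g) z = value_at f z + value_at g z"
proof -
  obtain a b where f: "quot_of_fract f = (a, b)" by fastforce
  obtain c d where g: "quot_of_fract g = (c, d)" by fastforce
  have "Fract a b = f" "Fract c d = g"
    using Fract_quot_of_fract[of f] Fract_quot_of_fract[of g] unfolding f g by simp_all
  note fg = this[symmetric]
  have nz: "poly b z \<noteq> 0" "poly d z \<noteq> 0"
    using assms f g by (auto simp: finite_at_def)
  hence eq: "f + g = Fract (a * d + c * b) (b * d)"
    unfolding fg by (intro add_fract) auto
  show "finite_at (f + g) z"
    unfolding eq using nz by (intro at_Fract) simp
  show "value_at (f + g) z = value_at f z + value_at g z"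
    unfolding eq unfolding fg using nz by (simp add: at_Fract add_frac_eq)
qed

lemma at_sum:
  assumes "finite S" and "\<And>j. j \<in> S \<Longrightarrow> finite_at (f j) z"
  shows "finite_at (\<Sum>j\<in>S. f j) z \<and> value_at (\<Sum>j\<in>S. f j) z = (\<Sum>j\<in>S. value_at (f j) z)"
  using assms
proof (induction S rule: finite_induct)
  case empty
  thus ?case using at_Fract[of 1 z 0] by (simp add: fract_collapse)
next
  case (insert j S)
  thus ?case by (simp add: at_add)
qed

lemma value_at_T_mat:
  assumes "p < n" "q < n" and z: "\<And>j. j \<in> {1..m} \<Longrightarrow> z \<noteq> \<alpha> j"
  shows "value_at (T_mat n m B \<alpha> $$ (p, q)) z =
    - B 0 $$ (p, q) + (if p = q then z else 0) + (\<Sum>j=1..m. B j $$ (p, q) / (z - \<alpha> j))"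
proof -
  \<comment> \<open>The polynomial part is kept as fractions with denominator \<open>1\<close>, so that \<open>at_Fract\<close> evaluates
    every summand.\<close>
  have eq: "T_mat n m B \<alpha> $$ (p, q) =
     Fract [: - (B 0 $$ (p, q)) :] 1 + Fract [: 0, if p = q then 1 else 0 :] 1
     + (\<Sum>j = 1..m. Fract [: B j $$ (p, q) :] [: - \<alpha> j, 1 :])"
    using assms(1,2) by (auto simp: T_mat_def fract_collapse)
  have "finite_at (Fract [: B j $$ (p, q) :] [: - \<alpha> j, 1 :]) z"
    and "value_at (Fract [: B j $$ (p, q) :] [: - \<alpha> j, 1 :]) z = B j $$ (p, q) / (z - \<alpha> j)"
    if "j \<in> {1..m}" for j
    using z[OF that] by (simp_all add: at_Fract)
  note sum = at_sum[OF finite_atLeastAtMost this(1)] this(2)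
  have "finite_at (Fract f 1) z" "value_at (Fract f 1) z = poly f z" for f
    by (simp_all add: at_Fract)
  note poly = this
  show ?thesis
    unfolding eq by (simp only: at_add poly sum) (simp add: sum)
qed

section \<open>Linearization\<close>

definition block_vec :: "nat \<Rightarrow> nat \<Rightarrow> (nat \<Rightarrow> 'a vec) \<Rightarrow> 'a vec" where
  "block_vec n k x = vec (k * n) (\<lambda>r. x (r div n) $ (r mod n))"

lemma block_mat_mult_block_vec:
  fixes F :: "nat \<Rightarrow> nat \<Rightarrow> 'a :: comm_semiring_0 mat"
  assumes r: "r < k * n"
    and F: "\<And>i j. i < k \<Longrightarrow> j < k \<Longrightarrow> F i j \<in> carrier_mat n n"
    and x: "\<And>j. j < k \<Longrightarrow> x j \<in> carrier_vec n"
  shows "(block_mat n k F *\<^sub>v block_vec n k x) $ r =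
    (\<Sum>j<k. (F (r div n) j *\<^sub>v x j) $ (r mod n))"
proof -
  have n: "0 < n" using r by (cases n) auto
  have i: "r div n < k" using r by (simp add: less_mult_imp_div_less)
  have p: "r mod n < n" using n by simp
  define g where "g s = F (r div n) (s div n) $$ (r mod n, s mod n) * x (s div n) $ (s mod n)" for s
  have "(block_mat n k F *\<^sub>v block_vec n k x) $ r = (\<Sum>s<k * n. g s)"
    using r by (simp add: block_mat_def block_vec_def scalar_prod_def g_def lessThan_atLeast0)
  also have "\<dots> = (\<Sum>j<k. \<Sum>s = j * n..<j * n + n. g s)"
    by (simp add: sum.nat_group)
  also have "\<dots> = (\<Sum>j<k. (F (r div n) j *\<^sub>v x j) $ (r mod n))"
  proof (rule sum.cong[OF refl])
    fix j assume "j \<in> {..<k}"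
    hence j: "j < k" by simp
    have "(\<Sum>s = j * n..<j * n + n. g s) = (\<Sum>q = 0..<n. g (q + j * n))"
      using sum.shift_bounds_nat_ivl[of g 0 "j * n" n] by (simp add: add.commute)
    also have "\<dots> = (F (r div n) j *\<^sub>v x j) $ (r mod n)"
      using F[OF i j] x[OF j] p by (auto simp: g_def scalar_prod_def intro!: sum.cong)
    finally show "(\<Sum>s = j * n..<j * n + n. g s) = (F (r div n) j *\<^sub>v x j) $ (r mod n)" .
  qed
  finally show ?thesis .
qed

definition linearization_vec ::
    "nat \<Rightarrow> nat \<Rightarrow> (nat \<Rightarrow> complex) \<Rightarrow> complex \<Rightarrow> complex vec \<Rightarrow> complex vec" where
  "linearization_vec n m \<alpha> z v = block_vec n (m + 1)
     (\<lambda>k. (if k < m then - 1 / (z - \<alpha> (k + 1)) else 1) \<cdot>\<^sub>v v)"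

text \<open>
  The second summand is \<open>D w\<close> for \<open>w = linearization_vec n m \<alpha> z v\<close>, where \<open>D\<close> is the block
  diagonal matrix of the poles, extended by \<open>0\<close> in the last block. In the last block row the
  identity is the hypothesis \<open>T(z) v = 0\<close>, in the others it is the choice of \<open>w\<close>.
\<close>
lemma linearization:
  fixes B :: "nat \<Rightarrow> complex mat"
  assumes B: "\<And>j. j \<le> m \<Longrightarrow> B j \<in> carrier_mat n n"
    and v: "v \<in> carrier_vec n"
    and z: "\<And>j. j \<in> {1..m} \<Longrightarrow> z \<noteq> \<alpha> j"
    and T: "map_mat (\<lambda>f. value_at f z) (T_mat n m B \<alpha>) *\<^sub>v v = 0\<^sub>v n"
  shows "z \<cdot>\<^sub>v linearization_vec n m \<alpha> z v =
    E_mat n m B *\<^sub>v linearization_vec n m \<alpha> z v +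
    vec ((m + 1) * n)
      (\<lambda>r. (if r div n < m then \<alpha> (r div n + 1) else 0) * linearization_vec n m \<alpha> z v $ r)"
proof (rule eq_vecI)
  let ?w = "linearization_vec n m \<alpha> z v"
  let ?Dw = "vec ((m + 1) * n) (\<lambda>r. (if r div n < m then \<alpha> (r div n + 1) else 0) * ?w $ r)"
  define c where "c k = (if k < m then - 1 / (z - \<alpha> (k + 1)) else 1)" for k
  define F where "F i j = (if i < m then (if j < m then 0\<^sub>m n n else - 1\<^sub>m n)
     else (if j < m then B (j + 1) else B 0))" for i j
  have E: "E_mat n m B = block_mat n (m + 1) F"
    unfolding E_mat_def F_def ..
  have w_eq: "?w = block_vec n (m + 1) (\<lambda>k. c k \<cdot>\<^sub>v v)"
    unfolding linearization_vec_def c_def ..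
  show "dim_vec (z \<cdot>\<^sub>v ?w) = dim_vec (E_mat n m B *\<^sub>v ?w + ?Dw)"
    by (simp add: w_eq block_vec_def)
  fix r assume "r < dim_vec (E_mat n m B *\<^sub>v ?w + ?Dw)"
  hence r: "r < (m + 1) * n" by simp
  define i p where "i = r div n" and "p = r mod n"
  have n: "0 < n" using r by (cases n) auto
  have p: "p < n" using n by (simp add: p_def)
  have i: "i < m + 1" unfolding i_def using r by (rule less_mult_imp_div_less)
  have wr: "?w $ r = c i * v $ p"
    using r p v by (simp add: w_eq block_vec_def i_def p_def)
  have F: "F i j \<in> carrier_mat n n" if "j < m + 1" for i j
    using B that by (auto simp: F_def)
  have "(E_mat n m B *\<^sub>v ?w) $ r = (\<Sum>j<m+1. (F i j *\<^sub>v (c j \<cdot>\<^sub>v v)) $ p)"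
    unfolding E w_eq i_def p_def using r F v by (intro block_mat_mult_block_vec) auto
  also have "\<dots> = (\<Sum>j<m+1. c j * (F i j *\<^sub>v v) $ p)"
  proof (rule sum.cong[OF refl])
    fix j assume "j \<in> {..<m+1}"
    hence "F i j \<in> carrier_mat n n" using F by simp
    thus "(F i j *\<^sub>v (c j \<cdot>\<^sub>v v)) $ p = c j * (F i j *\<^sub>v v) $ p"
      using v p by (simp add: mult_mat_vec)
  qed
  also have "\<dots> = (\<Sum>j<m. c j * (F i j *\<^sub>v v) $ p) + (F i m *\<^sub>v v) $ p"
    by (simp add: c_def)
  finally have Ew: "(E_mat n m B *\<^sub>v ?w) $ r =
      (\<Sum>j<m. c j * (F i j *\<^sub>v v) $ p) + (F i m *\<^sub>v v) $ p" .
  have "z * (c i * v $ p) = (E_mat n m B *\<^sub>v ?w) $ r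
      + (if i < m then \<alpha> (i + 1) else 0) * (c i * v $ p)"
  proof (cases "i < m")
    case True
    have "(E_mat n m B *\<^sub>v ?w) $ r = - v $ p"
      unfolding Ew using True p v by (simp add: F_def)
    moreover have "z * c i = - 1 + \<alpha> (i + 1) * c i"
      using z[of "i + 1"] True by (simp add: c_def divide_simps)
    ultimately show ?thesis using True by (simp add: left_diff_distrib flip: mult.assoc)
  next
    case False
    hence "i = m" using i by simp
    have shift: "b = c + a" if "0 = - a + b + - c" for a b c :: complex
      using that by (simp add: complex_eq_iff)
    have "0 = (map_mat (\<lambda>f. value_at f z) (T_mat n m B \<alpha>) *\<^sub>v v) $ p"
      using T p by simp
    also have "\<dots> = (\<Sum>q<n. value_at (T_mat n m B \<alpha> $$ (p, q)) z * v $ q)"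
    proof -
      have "T_mat n m B \<alpha> \<in> carrier_mat n n" by (simp add: T_mat_def)
      thus ?thesis
        using p v by (simp add: scalar_prod_def lessThan_atLeast0)
    qed
    also have "\<dots> = (\<Sum>q<n. (- B 0 $$ (p, q) + (if p = q then z else 0)
        + (\<Sum>j=1..m. B j $$ (p, q) / (z - \<alpha> j))) * v $ q)"
      by (intro sum.cong refl, subst value_at_T_mat[OF p _ z]) auto
    also have "\<dots> = - (\<Sum>q<n. B 0 $$ (p, q) * v $ q) + (\<Sum>q<n. if p = q then z * v $ q else 0)
        + (\<Sum>q<n. \<Sum>j=1..m. B j $$ (p, q) / (z - \<alpha> j) * v $ q)"
      unfolding sum_negf[symmetric] sum.distrib[symmetric]
      by (intro sum.cong refl) (simp add: algebra_simps sum_distrib_left)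
    also have "(\<Sum>q<n. if p = q then z * v $ q else 0) = z * v $ p"
      using p by simp
    also have "(\<Sum>q<n. B 0 $$ (p, q) * v $ q) = (F i m *\<^sub>v v) $ p"
      using B[of 0] p v \<open>i = m\<close> by (auto simp: F_def scalar_prod_def lessThan_atLeast0)
    also have "(\<Sum>q<n. \<Sum>j=1..m. B j $$ (p, q) / (z - \<alpha> j) * v $ q)
        = (\<Sum>j=1..m. \<Sum>q<n. B j $$ (p, q) / (z - \<alpha> j) * v $ q)"
      by (rule sum.swap)
    also have "\<dots> = (\<Sum>j<m. \<Sum>q<n. B (j+1) $$ (p, q) / (z - \<alpha> (j+1)) * v $ q)"
      by (rule sum.reindex_bij_witness[of _ "\<lambda>j. j + 1" "\<lambda>j. j - 1"]) auto
    also have "\<dots> = (\<Sum>j<m. - (c j * (F i j *\<^sub>v v) $ p))"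
    proof (rule sum.cong[OF refl])
      fix j assume "j \<in> {..<m}"
      hence j: "j < m" by simp
      have "(F i j *\<^sub>v v) $ p = (\<Sum>q<n. B (j+1) $$ (p, q) * v $ q)"
        using B[of "j + 1"] j p v \<open>i = m\<close> by (auto simp: F_def scalar_prod_def lessThan_atLeast0)
      thus "(\<Sum>q<n. B (j+1) $$ (p, q) / (z - \<alpha> (j+1)) * v $ q) = - (c j * (F i j *\<^sub>v v) $ p)"
        using j by (simp add: c_def sum_divide_distrib)
    qed
    finally have "z * v $ p = (\<Sum>j<m. c j * (F i j *\<^sub>v v) $ p) + (F i m *\<^sub>v v) $ p"
      unfolding sum_negf by (rule shift)
    thus ?thesis
      unfolding Ew using \<open>i = m\<close> by (simp add: c_def)
  qed
  thus "(z \<cdot>\<^sub>v ?w) $ r = (E_mat n m B *\<^sub>v ?w + ?Dw) $ r"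
    using r wr by (simp add: w_eq block_vec_def i_def)
qed

section \<open>The eigenvalue bound\<close>

theorem theorem2p2:
  fixes n m :: nat
    and B :: "nat \<Rightarrow> complex mat"
    and \<alpha> :: "nat \<Rightarrow> complex"
    and \<nu> :: "complex vec \<Rightarrow> real"
    and \<mu> :: "complex mat \<Rightarrow> real"
    and z :: complex
  assumes "n \<ge> 1" and "m \<ge> 1"
    and "\<And>j. j \<le> m \<Longrightarrow> B j \<in> carrier_mat n n"
    and "strict_mono_on {1..m} (\<lambda>j. cmod (\<alpha> j))"
    and "absolute_norm ((m + 1) * n) \<nu>"
    and "induced_matrix_norm ((m + 1) * n) \<nu> \<mu>"
    and "rational_eigenvalue (T_mat n m B \<alpha>) z"
  shows "cmod z \<le> \<mu> (E_mat n m B) + cmod (\<alpha> m)"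
proof -
  let ?N = "(m + 1) * n" and ?E = "E_mat n m B"
  have nrm: "is_norm ?N \<nu>" using assms(5) by (simp add: absolute_norm_def)
  have E: "?E \<in> carrier_mat ?N ?N" by (simp add: E_mat_def block_mat_def)
  have alpha: "cmod (\<alpha> j) \<le> cmod (\<alpha> m)" if "j \<in> {1..m}" for j
    using strict_mono_onD[OF assms(4), of j m] that by (cases "j = m") auto
  show ?thesis
  proof (cases "z \<in> \<alpha> ` {1..m}")
    case True
    moreover have "0 \<le> \<mu> ?E"
      using assms(1) by (intro induced_matrix_norm_nonneg[OF assms(5,6) E]) simp
    ultimately show ?thesis using alpha by force
  next
    case False
    hence z: "\<And>j. j \<in> {1..m} \<Longrightarrow> z \<noteq> \<alpha> j" by auto
    have "dim_row (T_mat n m B \<alpha>) = n" "dim_col (T_mat n m B \<alpha>) = n"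
      by (simp_all add: T_mat_def)
    then obtain v where v: "v \<in> carrier_vec n" "v \<noteq> 0\<^sub>v n"
      and T: "map_mat (\<lambda>f. value_at f z) (T_mat n m B \<alpha>) *\<^sub>v v = 0\<^sub>v n"
      using assms(7) unfolding rational_eigenvalue_def by auto
    define w where "w = linearization_vec n m \<alpha> z v"
    define y where "y = vec ?N (\<lambda>r. (if r div n < m then \<alpha> (r div n + 1) else 0) * w $ r)"
    have car: "w \<in> carrier_vec ?N" "y \<in> carrier_vec ?N"
      by (simp_all add: w_def y_def linearization_vec_def block_vec_def)
    \<comment> \<open>The last block of \<open>w\<close> is \<open>v\<close>.\<close>
    obtain p where p: "p < n" "v $ p \<noteq> 0"
      using v by (metis carrier_vecD eq_vecI index_zero_vec)
    have "w $ (m * n + p) = v $ p"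
      using p v by (simp add: w_def linearization_vec_def block_vec_def)
    hence "w \<noteq> 0\<^sub>v ?N" using p by auto
    hence pos: "0 < \<nu> w"
      using nrm car by (intro is_norm_pos)
    have "\<nu> y \<le> \<nu> (complex_of_real (cmod (\<alpha> m)) \<cdot>\<^sub>v w)"
    proof (rule absolute_norm_mono[OF assms(5)])
      fix r assume r: "r < ?N"
      have "cmod (if r div n < m then \<alpha> (r div n + 1) else 0) \<le> cmod (\<alpha> m)"
        using alpha by auto
      thus "cmod (y $ r) \<le> cmod ((complex_of_real (cmod (\<alpha> m)) \<cdot>\<^sub>v w) $ r)"
        using r car by (simp add: y_def norm_mult mult_right_mono del: if_split)
    qed (use car in auto)
    hence y: "\<nu> y \<le> cmod (\<alpha> m) * \<nu> w"
      using nrm car by (simp add: is_norm_def)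
    have "cmod z * \<nu> w = \<nu> (z \<cdot>\<^sub>v w)"
      using nrm car by (simp add: is_norm_def)
    also have "z \<cdot>\<^sub>v w = ?E *\<^sub>v w + y"
      unfolding w_def y_def by (rule linearization[OF assms(3) v(1) z T])
    also have "\<nu> (?E *\<^sub>v w + y) \<le> \<nu> (?E *\<^sub>v w) + \<nu> y"
      using nrm E car unfolding is_norm_def by (meson mult_mat_vec_carrier)
    also have "\<dots> \<le> \<mu> ?E * \<nu> w + cmod (\<alpha> m) * \<nu> w"
      by (intro add_mono induced_matrix_norm_bound[OF assms(5,6) E] car y)
    finally have "cmod z * \<nu> w \<le> (\<mu> ?E + cmod (\<alpha> m)) * \<nu> w"
      by (simp add: algebra_simps)
    thus ?thesis using pos by simp
  qed
qed

end
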